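(* Let $c_1,c_2,\lambda\in\mathbb{R}$ and let $(M,g)$ be a 2-dimensional (pseudo-)Riemannian manifold with Gauss curvature $K$ such that $(1+c_1c_2)K+\lambda c_1$ is nowhere zero. If a 1-form $X_a$ with $\nabla_{[a}X_{b]}=0$ satisfies the generalised Ricci soliton equation $$\nabla_{(a}X_{b)}+c_1X_aX_b-c_2R_{ab}=\lambda g_{ab},$$ then necessarily $$X_a=-\frac{c_2\nabla_aK}{(1+c_1c_2)K+\lambda c_1}.$$ Conversely, if the 1-form $X_a$ given by this formula satisfies the generalised Ricci soliton equation, then $(M,g)$ admits a solution of the gradient generalised Ricci soliton equations, i.e. $X_a$ is a solution with $\nabla_{[a}X_{b]}=0$.
   Context: $\nabla$ is the Levi-Civita connection of $g$; round and square brackets denote symmetrisation and antisymmetrisation (with factor $\tfrac12$). In dimension 2 the Ricci tensor is $R_{ab}=Kg_{ab}$. *)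

theory Defs
  imports "HOL-Analysis.Analysis"
begin

section \<open>Smooth functions on open subsets of coordinate space\<close>

definition partial :: "'n \<Rightarrow> (real^'n \<Rightarrow> real) \<Rightarrow> real^'n \<Rightarrow> real" where
  "partial i f x = frechet_derivative f (at x) (axis i 1)"

text \<open>Only meant for open \<^term>\<open>S\<close>, where \<^const>\<open>differentiable_on\<close> is ordinary differentiability
  at every point and \<^const>\<open>partial\<close> computes the true partial derivatives.\<close>

fun C_on :: "nat \<Rightarrow> (real^'n) set \<Rightarrow> (real^'n \<Rightarrow> real) \<Rightarrow> bool" where
  "C_on 0 S f \<longleftrightarrow> continuous_on S f"
| "C_on (Suc k) S f \<longleftrightarrow> f differentiable_on S \<and> (\<forall>i. C_on k S (partial i f))"

definition smooth_on :: "(real^'n) set \<Rightarrow> (real^'n \<Rightarrow> real) \<Rightarrow> bool" where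
  "smooth_on S f \<longleftrightarrow> (\<forall>k. C_on k S f)"

section \<open>Smooth manifolds\<close>

text \<open>A chart is a pair of its domain and its coordinate map. The values of the coordinate map outside
  the domain carry no information.\<close>

type_synonym ('a, 'n) chart = "'a set \<times> ('a \<Rightarrow> real^'n)"

abbreviation chart_dom :: "('a, 'n) chart \<Rightarrow> 'a set" where
  "chart_dom \<equiv> fst"

abbreviation coord :: "('a, 'n) chart \<Rightarrow> 'a \<Rightarrow> real^'n" where
  "coord \<equiv> snd"

abbreviation chart_ran :: "('a, 'n) chart \<Rightarrow> (real^'n) set" where
  "chart_ran c \<equiv> coord c ` chart_dom c"

definition chart_inv :: "('a, 'n) chart \<Rightarrow> real^'n \<Rightarrow> 'a" where
  "chart_inv c = inv_into (chart_dom c) (coord c)"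

definition is_chart :: "'a topology \<Rightarrow> ('a, 'n::finite) chart \<Rightarrow> bool" where
  "is_chart M c \<longleftrightarrow> openin M (chart_dom c) \<and> open (chart_ran c) \<and>
     homeomorphic_map (subtopology M (chart_dom c)) (top_of_set (chart_ran c)) (coord c)"

definition overlap :: "('a, 'n) chart \<Rightarrow> ('a, 'n) chart \<Rightarrow> (real^'n) set" where
  "overlap c d = coord c ` (chart_dom c \<inter> chart_dom d)"

definition transition :: "('a, 'n) chart \<Rightarrow> ('a, 'n) chart \<Rightarrow> real^'n \<Rightarrow> real^'n" where
  "transition c d x = coord d (chart_inv c x)"

text \<open>The atlas need not be maximal; the maximal one is a special case.\<close>

definition smooth_manifold :: "'a topology \<Rightarrow> ('a, 'n::finite) chart set \<Rightarrow> bool" where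
  "smooth_manifold M A \<longleftrightarrow>
     Hausdorff_space M \<and>
     (\<exists>B. countable B \<and> (\<forall>V\<in>B. openin M V) \<and>
        (\<forall>U p. openin M U \<and> p \<in> U \<longrightarrow> (\<exists>V\<in>B. p \<in> V \<and> V \<subseteq> U))) \<and>
     (\<forall>c\<in>A. is_chart M c) \<and>
     (\<Union>c\<in>A. chart_dom c) = topspace M \<and>
     (\<forall>c\<in>A. \<forall>d\<in>A. \<forall>k. smooth_on (overlap c d) (\<lambda>x. transition c d x $ k))"

section \<open>Tensor fields\<close>

text \<open>A covariant tensor field is given by its components in every chart of the atlas, as functions of the
  coordinates, subject to the tensor transformation law on overlaps of charts. Components are
  relevant only for charts in the atlas and at points of their range.\<close>

type_synonym ('a, 'n) covec_field = "('a, 'n) chart \<Rightarrow> real^'n \<Rightarrow> real^'n"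
type_synonym ('a, 'n) cotensor2_field = "('a, 'n) chart \<Rightarrow> real^'n \<Rightarrow> real^'n^'n"

text \<open>\<^term>\<open>transition_jac c d x k i\<close> is the derivative of the \<^term>\<open>k\<close>-th coordinate of the chart \<^term>\<open>d\<close>
  with respect to the \<^term>\<open>i\<close>-th coordinate of the chart \<^term>\<open>c\<close>.\<close>

definition transition_jac :: "('a, 'n) chart \<Rightarrow> ('a, 'n) chart \<Rightarrow> real^'n \<Rightarrow> 'n \<Rightarrow> 'n \<Rightarrow> real" where
  "transition_jac c d x k i = partial i (\<lambda>y. transition c d y $ k) x"

definition smooth_one_form :: "('a, 'n::finite) chart set \<Rightarrow> ('a, 'n) covec_field \<Rightarrow> bool" where
  "smooth_one_form A X \<longleftrightarrow>
     (\<forall>c\<in>A. \<forall>a. smooth_on (chart_ran c) (\<lambda>x. X c x $ a)) \<and>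
     (\<forall>c\<in>A. \<forall>d\<in>A. \<forall>x\<in>overlap c d. \<forall>a.
        X c x $ a = (\<Sum>k\<in>UNIV. transition_jac c d x k a * X d (transition c d x) $ k))"

definition smooth_cotensor2 :: "('a, 'n::finite) chart set \<Rightarrow> ('a, 'n) cotensor2_field \<Rightarrow> bool" where
  "smooth_cotensor2 A T \<longleftrightarrow>
     (\<forall>c\<in>A. \<forall>a b. smooth_on (chart_ran c) (\<lambda>x. T c x $ a $ b)) \<and>
     (\<forall>c\<in>A. \<forall>d\<in>A. \<forall>x\<in>overlap c d. \<forall>a b.
        T c x $ a $ b =
          (\<Sum>k\<in>UNIV. \<Sum>l\<in>UNIV. transition_jac c d x k a * transition_jac c d x l b * T d (transition c d x) $ k $ l))"

definition pseudo_riemannian_manifold ::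
    "'a topology \<Rightarrow> ('a, 'n::finite) chart set \<Rightarrow> ('a, 'n) cotensor2_field \<Rightarrow> bool" where
  "pseudo_riemannian_manifold M A g \<longleftrightarrow>
     smooth_manifold M A \<and> smooth_cotensor2 A g \<and>
     (\<forall>c\<in>A. \<forall>x\<in>chart_ran c. transpose (g c x) = g c x \<and> det (g c x) \<noteq> 0)"

section \<open>Levi-Civita connection and curvature in coordinates\<close>

text \<open>Here \<^term>\<open>G\<close> is the matrix of components of the metric in one chart.\<close>

definition christoffel :: "(real^'n \<Rightarrow> real^'n^'n) \<Rightarrow> real^'n \<Rightarrow> 'n::finite \<Rightarrow> 'n \<Rightarrow> 'n \<Rightarrow> real" where
  "christoffel G x k i j =
     1/2 * (\<Sum>l\<in>UNIV. matrix_inv (G x) $ k $ l *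
        (partial i (\<lambda>y. G y $ j $ l) x + partial j (\<lambda>y. G y $ i $ l) x
          - partial l (\<lambda>y. G y $ i $ j) x))"

text \<open>The Christoffel symbols are those of the Levi-Civita connection: the connection they define is
  torsion-free and metric.\<close>

lemma partial_metric_commute:
  assumes "open S" "x \<in> S" and sym: "\<And>y. y \<in> S \<Longrightarrow> transpose (G y) = G y"
    and diff: "\<And>a b. (\<lambda>y. G y $ a $ b) differentiable (at x)"
  shows "partial l (\<lambda>y. G y $ i $ j) x = partial l (\<lambda>y. G y $ j $ i) x"
proof -
  have "((\<lambda>y. G y $ j $ i) has_derivative frechet_derivative (\<lambda>y. G y $ i $ j) (at x)) (at x)"
  proof (rule has_derivative_transform_within_open[OF _ assms(1,2)])
    show "((\<lambda>y. G y $ i $ j) has_derivative frechet_derivative (\<lambda>y. G y $ i $ j) (at x)) (at x)"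
      using diff frechet_derivative_works by blast
    show "G y $ i $ j = G y $ j $ i" if "y \<in> S" for y
      using arg_cong[OF sym[OF that], of "\<lambda>m. m $ j $ i"] by (simp add: transpose_def)
  qed
  from frechet_derivative_at[OF this] show ?thesis
    unfolding partial_def by simp
qed

lemma christoffel_torsion_free:
  assumes "open S" "x \<in> S" "\<And>y. y \<in> S \<Longrightarrow> transpose (G y) = G y"
    and "\<And>a b. (\<lambda>y. G y $ a $ b) differentiable (at x)"
  shows "christoffel G x k i j = christoffel G x k j i"
  unfolding christoffel_def
  by (subst partial_metric_commute[where i = i and j = j, OF assms]) (simp_all add: add.commute)

lemma christoffel_metric:
  assumes "open S" "x \<in> S" "\<And>y. y \<in> S \<Longrightarrow> transpose (G y) = G y"
    and "\<And>a b. (\<lambda>y. G y $ a $ b) differentiable (at x)"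
    and det: "det (G x) \<noteq> 0"
  shows "partial k (\<lambda>y. G y $ i $ j) x
    - (\<Sum>m\<in>UNIV. christoffel G x m k i * G x $ m $ j)
    - (\<Sum>m\<in>UNIV. christoffel G x m k j * G x $ i $ m) = 0"
proof -
  define P where "P k i j = partial k (\<lambda>y. G y $ i $ j) x" for k i j
  have P: "P l i j = P l j i" for l i j
    unfolding P_def by (rule partial_metric_commute[OF assms(1-4)])
  have Gs: "G x $ a $ b = G x $ b $ a" for a b
    using arg_cong[OF assms(3)[OF assms(2)], of "\<lambda>m. m $ b $ a"] by (simp add: transpose_def)
  have "invertible (G x)"
    using det by (simp add: invertible_det_nz)
  then have inv: "G x ** matrix_inv (G x) = mat 1"
    unfolding invertible_def matrix_inv_def by (rule someI2_ex) simp
  have lower: "(\<Sum>m\<in>UNIV. christoffel G x m k i * G x $ j $ m) = 1/2 * (P k i j + P i k j - P j k i)"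
    for k i j
  proof -
    have "(\<Sum>m\<in>UNIV. christoffel G x m k i * G x $ j $ m) =
        (\<Sum>m\<in>UNIV. \<Sum>l\<in>UNIV. (1/2 * (P k i l + P i k l - P l k i)) * (G x $ j $ m * matrix_inv (G x) $ m $ l))"
      unfolding christoffel_def P_def[symmetric]
      by (simp only: sum_distrib_left sum_distrib_right mult_ac)
    also have "\<dots> = (\<Sum>l\<in>UNIV. (1/2 * (P k i l + P i k l - P l k i)) * (G x ** matrix_inv (G x)) $ j $ l)"
      by (subst sum.swap) (simp only: matrix_matrix_mult_def sum_distrib_left vec_lambda_beta)
    also have "\<dots> = (\<Sum>l\<in>UNIV. if l = j then 1/2 * (P k i l + P i k l - P l k i) else 0)"
      unfolding inv by (intro sum.cong refl) (simp add: mat_def)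
    also have "\<dots> = 1/2 * (P k i j + P i k j - P j k i)"
      by (simp only: sum.delta finite UNIV_I if_True)
    finally show ?thesis .
  qed
  have "(\<Sum>m\<in>UNIV. christoffel G x m k i * G x $ m $ j) = (\<Sum>m\<in>UNIV. christoffel G x m k i * G x $ j $ m)"
    by (rule sum.cong) (simp_all only: Gs[of _ j])
  also have "\<dots> = 1/2 * (P k i j + P i k j - P j k i)"
    by (rule lower)
  finally have 1: "(\<Sum>m\<in>UNIV. christoffel G x m k i * G x $ m $ j) = 1/2 * (P k i j + P i k j - P j k i)" .
  show ?thesis
    unfolding P_def[symmetric] 1 lower[of k j i] using P[of k i j] by (simp add: field_simps)
qed

text \<open>\<^term>\<open>riemann G x l k i j\<close> is the component along the \<^term>\<open>l\<close>-th coordinate field of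
  $R(\partial_i,\partial_j)\partial_k$, where
  $R(U,V)W = \nabla_U\nabla_V W - \nabla_V\nabla_U W - \nabla_{[U,V]}W$. With the contraction used for the
  Ricci tensor, round spheres have positive curvature.\<close>

definition riemann ::
    "(real^'n \<Rightarrow> real^'n^'n) \<Rightarrow> real^'n \<Rightarrow> 'n::finite \<Rightarrow> 'n \<Rightarrow> 'n \<Rightarrow> 'n \<Rightarrow> real" where
  "riemann G x l k i j =
     partial i (\<lambda>y. christoffel G y l j k) x - partial j (\<lambda>y. christoffel G y l i k) x
     + (\<Sum>m\<in>UNIV. christoffel G x l i m * christoffel G x m j k
                  - christoffel G x l j m * christoffel G x m i k)"

definition ricci :: "(real^'n \<Rightarrow> real^'n^'n) \<Rightarrow> real^'n \<Rightarrow> 'n::finite \<Rightarrow> 'n \<Rightarrow> real" where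
  "ricci G x a b = (\<Sum>m\<in>UNIV. riemann G x m a m b)"

text \<open>$K = g(R(\partial_1,\partial_2)\partial_2,\partial_1) / \det g$.\<close>

definition gauss_coord :: "(real^2 \<Rightarrow> real^2^2) \<Rightarrow> real^2 \<Rightarrow> real" where
  "gauss_coord G x = (\<Sum>m\<in>UNIV. G x $ 1 $ m * riemann G x m 2 1 2) / det (G x)"

definition is_gauss_curvature ::
    "('a, 2) chart set \<Rightarrow> ('a, 2) cotensor2_field \<Rightarrow> ('a \<Rightarrow> real) \<Rightarrow> bool" where
  "is_gauss_curvature A g K \<longleftrightarrow>
     (\<forall>c\<in>A. \<forall>p\<in>chart_dom c. K p = gauss_coord (g c) (coord c p))"

section \<open>Covariant derivatives\<close>

definition nabla_scalar :: "('a, 'n) chart \<Rightarrow> ('a \<Rightarrow> real) \<Rightarrow> real^'n \<Rightarrow> 'n \<Rightarrow> real" where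
  "nabla_scalar c f x a = partial a (\<lambda>y. f (chart_inv c y)) x"

text \<open>The first index is that of the derivative: $\nabla_a X_b$.\<close>

definition nabla ::
    "('a, 'n) cotensor2_field \<Rightarrow> ('a, 'n) covec_field \<Rightarrow> ('a, 'n) chart \<Rightarrow> real^'n \<Rightarrow> 'n::finite \<Rightarrow> 'n \<Rightarrow> real"
  where
  "nabla g X c x a b =
     partial a (\<lambda>y. X c y $ b) x - (\<Sum>m\<in>UNIV. christoffel (g c) x m a b * X c x $ m)"

definition symm :: "('n \<Rightarrow> 'n \<Rightarrow> real) \<Rightarrow> 'n \<Rightarrow> 'n \<Rightarrow> real" where
  "symm T a b = 1/2 * (T a b + T b a)"

definition antisymm :: "('n \<Rightarrow> 'n \<Rightarrow> real) \<Rightarrow> 'n \<Rightarrow> 'n \<Rightarrow> real" where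
  "antisymm T a b = 1/2 * (T a b - T b a)"

section \<open>Generalised Ricci solitons\<close>

definition closed_one_form ::
    "('a, 'n::finite) chart set \<Rightarrow> ('a, 'n) cotensor2_field \<Rightarrow> ('a, 'n) covec_field \<Rightarrow> bool" where
  "closed_one_form A g X \<longleftrightarrow>
     (\<forall>c\<in>A. \<forall>x\<in>chart_ran c. \<forall>a b. antisymm (nabla g X c x) a b = 0)"

definition gen_ricci_soliton ::
    "('a, 'n::finite) chart set \<Rightarrow> ('a, 'n) cotensor2_field \<Rightarrow> real \<Rightarrow> real \<Rightarrow> real \<Rightarrow> ('a, 'n) covec_field \<Rightarrow> bool"
  where
  "gen_ricci_soliton A g c\<^sub>1 c\<^sub>2 lam X \<longleftrightarrow>
     (\<forall>c\<in>A. \<forall>x\<in>chart_ran c. \<forall>a b.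
        symm (nabla g X c x) a b + c\<^sub>1 * X c x $ a * X c x $ b - c\<^sub>2 * ricci (g c) x a b
          = lam * g c x $ a $ b)"

definition gradient_gen_ricci_soliton ::
    "('a, 'n::finite) chart set \<Rightarrow> ('a, 'n) cotensor2_field \<Rightarrow> real \<Rightarrow> real \<Rightarrow> real \<Rightarrow> ('a, 'n) covec_field \<Rightarrow> bool"
  where
  "gradient_gen_ricci_soliton A g c\<^sub>1 c\<^sub>2 lam X \<longleftrightarrow>
     smooth_one_form A X \<and> closed_one_form A g X \<and> gen_ricci_soliton A g c\<^sub>1 c\<^sub>2 lam X"

end

theory Submission
  imports Defs
begin

text \<open>
For a closed form $X$ the symmetrisation in the soliton equation is vacuous. On a surface
$R_{ab} = K g_{ab}$, so the equation becomes
\[ \nabla_a X_b = \mu g_{ab} - c_1 X_a X_b, \qquad \mu = c_2 K + \lambda, \]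
which expresses all derivatives of $X$ algebraically. Such an overdetermined system has an
integrability condition: commuting covariant derivatives by the Ricci identity
(\<open>ricci_identity\<close>) and substituting the equation gives (\<open>prolongation\<close>)
\[ - R^m{}_{cij} X_m = (\nabla_i \mu + c_1 \mu X_i) g_{jc} - (\nabla_j \mu + c_1 \mu X_j) g_{ic}. \]
On a surface the left-hand side is $- K (X_i g_{jc} - X_j g_{ic})$ by \<open>riemann_2\<close>, so that
$Y_i g_{jc} = Y_j g_{ic}$ for
$Y = c_2 \nabla K + ((1 + c_1 c_2) K + \lambda c_1) X$. Nondegeneracy of $g$ forces $Y = 0$
(\<open>gradient_soliton_2\<close>), and this is the formula for $X$ because the coefficient of $X$ does not
vanish.

Conversely, the form given by the formula is the differential of $K$ times a function of $K$. It is
therefore smooth, transforms as a covector (\<open>nabla_scalar_transform\<close>) and is closed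
(\<open>antisymm_nabla_quotient\<close>).

Both directions rest on Schwarz's theorem (\<open>partial_commute\<close>): it is applied to the components
of $X$ in the Ricci identity, to those of $g$ in the skew symmetry of the curvature, and to $K$ in
the converse. To differentiate $K$ it has to be known that $K$ is smooth; it is built from
the metric by differentiation, field operations and matrix inversion, which preserve smoothness.
\<close>

section \<open>Rules for partial derivatives\<close>

lemma partial_has_derivative: "(f has_derivative f') (at x) \<Longrightarrow> partial i f x = f' (axis i 1)"
  unfolding partial_def by (metis frechet_derivative_at)

text \<open>The nondifferentiable case needs an argument: \<^const>\<open>frechet_derivative\<close> is a choice among the derivatives,
so two functions with the same (possibly empty) set of derivatives have the same, possibly
meaningless, partial.\<close>

lemma partial_cong:
  assumes "open S" "x \<in> S" "\<And>y. y \<in> S \<Longrightarrow> f y = g y"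
  shows "partial i f x = partial i g x"
proof (cases "f differentiable (at x)")
  case True
  then have "frechet_derivative f (at x) = frechet_derivative g (at x)"
    using assms frechet_derivative_transform_within_open by blast
  then show ?thesis by (simp add: partial_def)
next
  case False
  have "(f has_derivative D) (at x) \<longleftrightarrow> (g has_derivative D) (at x)" for D
    using assms has_derivative_transform_within_open[of _ _ x UNIV S] by (metis (mono_tags))
  then show ?thesis by (simp add: partial_def frechet_derivative_def)
qed

lemma partial_const: "partial i (\<lambda>y. k) x = 0"
  by (simp add: partial_def)

lemma partial_add:
  assumes "f differentiable (at x)" "g differentiable (at x)"
  shows "partial i (\<lambda>y. f y + g y) x = partial i f x + partial i g x"
  using partial_has_derivative[OF has_derivative_add[OF assms[unfolded frechet_derivative_works]]]
  by (simp add: partial_def)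


lemma partial_diff:
  assumes "f differentiable (at x)" "g differentiable (at x)"
  shows "partial i (\<lambda>y. f y - g y) x = partial i f x - partial i g x"
  using partial_has_derivative[OF has_derivative_diff[OF assms[unfolded frechet_derivative_works]]]
  by (simp add: partial_def)

lemma partial_mult:
  assumes "f differentiable (at x)" "g differentiable (at x)"
  shows "partial i (\<lambda>y. f y * g y) x = partial i f x * g x + f x * partial i g x"
  using partial_has_derivative[OF has_derivative_mult[OF assms[unfolded frechet_derivative_works]]]
  by (simp add: partial_def)

lemma partial_cmult:
  assumes "f differentiable (at x)"
  shows "partial i (\<lambda>y. k * f y) x = k * partial i f x"
  using partial_mult[of "\<lambda>y. k" x f i] assms by (simp add: partial_const)

lemma partial_sum:
  assumes "\<And>m. m \<in> I \<Longrightarrow> f m differentiable (at x)"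
  shows "partial i (\<lambda>y. \<Sum>m\<in>I. f m y) x = (\<Sum>m\<in>I. partial i (f m) x)"
proof -
  have "((\<lambda>y. \<Sum>m\<in>I. f m y) has_derivative (\<lambda>h. \<Sum>m\<in>I. frechet_derivative (f m) (at x) h)) (at x)"
    using assms by (intro has_derivative_sum) (simp add: frechet_derivative_works)
  from partial_has_derivative[OF this] show ?thesis by (simp add: partial_def)
qed

lemma partial_inverse:
  assumes "f differentiable (at x)" "f x \<noteq> 0"
  shows "partial i (\<lambda>y. inverse (f y)) x = - (partial i f x * (inverse (f x) * inverse (f x)))"
  using partial_has_derivative[OF Deriv.has_derivative_inverse[OF assms(2) assms(1)[unfolded frechet_derivative_works]]]
  by (simp add: partial_def mult_ac)

lemma partial_compose:
  fixes T :: "real^'m \<Rightarrow> real^'n" and v :: "real^'n \<Rightarrow> real"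
  assumes v: "v differentiable (at (T x))" and T: "\<And>k. (\<lambda>y. T y $ k) differentiable (at x)"
  shows "partial a (\<lambda>y. v (T y)) x = (\<Sum>k\<in>UNIV. partial a (\<lambda>y. T y $ k) x * partial k v (T x))"
proof -
  define T' where "T' h = (\<chi> k. frechet_derivative (\<lambda>y. T y $ k) (at x) h)" for h
  define v' where "v' = frechet_derivative v (at (T x))"
  have "(T has_derivative T') (at x)"
    unfolding has_derivative_componentwise_within[of T] 
    using T by (auto simp: T'_def Basis_vec_def inner_axis frechet_derivative_works)
  moreover have v': "(v has_derivative v') (at (T x))"
    using v by (simp add: v'_def frechet_derivative_works)
  ultimately have "((\<lambda>y. v (T y)) has_derivative (\<lambda>h. v' (T' h))) (at x)"
    by (rule has_derivative_compose)
  then have "partial a (\<lambda>y. v (T y)) x = v' (T' (axis a 1))"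
    by (rule partial_has_derivative)
  also have "T' (axis a 1) = (\<Sum>k\<in>UNIV. partial a (\<lambda>y. T y $ k) x *\<^sub>R axis k 1)"
    by (simp add: T'_def partial_def vec_eq_iff axis_def if_distrib cong: if_cong)
  also have "v' \<dots> = (\<Sum>k\<in>UNIV. partial a (\<lambda>y. T y $ k) x * v' (axis k 1))"
    using has_derivative_linear[OF v'] by (simp add: linear_sum linear_cmul)
  finally show ?thesis by (simp add: v'_def partial_def)
qed

section \<open>Algebra of smooth functions\<close>

lemma smooth_on_differentiable:
  assumes "open S" "smooth_on S f" "x \<in> S"
  shows "f differentiable (at x)"
proof -
  have "C_on (Suc 0) S f" using assms(2) unfolding smooth_on_def by blast
  then show ?thesis using assms by (simp add: differentiable_on_eq_differentiable_at)
qed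

lemma smooth_on_partial: "smooth_on S f \<Longrightarrow> smooth_on S (partial i f)"
  unfolding smooth_on_def by (metis C_on.simps(2))

lemma C_on_Suc: "C_on (Suc k) S f \<Longrightarrow> C_on k S f"
  by (induction k arbitrary: f) (simp_all add: differentiable_imp_continuous_on)

lemma C_on_SucD:
  assumes "open S" "C_on (Suc k) S f"
  shows "x \<in> S \<Longrightarrow> f differentiable (at x)" "C_on k S (partial i f)"
  using assms by (simp_all add: differentiable_on_eq_differentiable_at)

lemma C_on_cong:
  assumes "open S" "C_on k S f" "\<And>y. y \<in> S \<Longrightarrow> f y = g y"
  shows "C_on k S g"
  using assms(2,3)
proof (induction k arbitrary: f g)
  case 0
  then show ?case by (auto cong: continuous_on_cong)
next
  case (Suc k)
  have "C_on k S (partial i g)" for i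
  proof (rule Suc.IH)
    show "C_on k S (partial i f)" using Suc.prems(1) by simp
    show "partial i f y = partial i g y" if "y \<in> S" for y
      using assms(1) that Suc.prems(2) by (rule partial_cong)
  qed
  moreover have "g differentiable (at x)" if "x \<in> S" for x
  proof -
    have "(f has_derivative frechet_derivative f (at x)) (at x)"
      using C_on_SucD(1)[OF assms(1) Suc.prems(1) that] by (simp add: frechet_derivative_works)
    then have "(g has_derivative frechet_derivative f (at x)) (at x)"
      using assms(1) that Suc.prems(2) by (rule has_derivative_transform_within_open)
    then show ?thesis by (rule differentiableI)
  qed
  ultimately show ?case
    using assms(1) by (simp add: differentiable_on_eq_differentiable_at)
qed

lemma smooth_on_cong:
  assumes "open S" "smooth_on S f" "\<And>y. y \<in> S \<Longrightarrow> f y = g y"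
  shows "smooth_on S g"
  using assms C_on_cong unfolding smooth_on_def by blast

lemma C_on_const: "C_on k S (\<lambda>y. r)"
  by (induction k arbitrary: r) (simp_all add: partial_const[abs_def])

text \<open>Lets the inductions below replace the partials of a sum, product or inverse by the formulas that
the differentiation rules give, which are only correct on \<^term>\<open>S\<close>.\<close>

lemma C_on_SucI:
  assumes "open S" "\<And>x. x \<in> S \<Longrightarrow> f differentiable (at x)"
    and "\<And>i. C_on k S (f' i)" "\<And>i x. x \<in> S \<Longrightarrow> f' i x = partial i f x"
  shows "C_on (Suc k) S f"
  using assms C_on_cong[OF assms(1,3,4)] by (simp add: differentiable_on_eq_differentiable_at)

lemma C_on_add:
  assumes "open S" "C_on k S f" "C_on k S g"
  shows "C_on k S (\<lambda>y. f y + g y)"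
  using assms(2,3)
proof (induction k arbitrary: f g)
  case (Suc k)
  note D = C_on_SucD[OF assms(1)]
  show ?case
  proof (rule C_on_SucI[OF assms(1)])
    show "C_on k S (\<lambda>y. partial i f y + partial i g y)" for i
      by (rule Suc.IH) (rule D(2), fact)+
  qed (simp_all add: partial_add D(1)[OF Suc.prems(1)] D(1)[OF Suc.prems(2)])
qed (simp add: continuous_on_add)

lemma C_on_mult:
  assumes "open S" "C_on k S f" "C_on k S g"
  shows "C_on k S (\<lambda>y. f y * g y)"
  using assms(2,3)
proof (induction k arbitrary: f g)
  case (Suc k)
  note D = C_on_SucD[OF assms(1)]
  show ?case
  proof (rule C_on_SucI[OF assms(1)])
    show "C_on k S (\<lambda>y. partial i f y * g y + f y * partial i g y)" for i
      using Suc.prems D(2) C_on_Suc assms(1) by (intro C_on_add Suc.IH) blast+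
  qed (simp_all add: partial_mult D(1)[OF Suc.prems(1)] D(1)[OF Suc.prems(2)])
qed (simp add: continuous_on_mult)

text \<open>The induction closes because the derivative of $1/f$ is $-\partial_i f \cdot (1/f)^2$: apart
from $\partial_i f$ it involves only $1/f$ itself, at one order of smoothness less.\<close>

lemma C_on_inverse:
  assumes "open S" "C_on k S f" "\<And>y. y \<in> S \<Longrightarrow> f y \<noteq> 0"
  shows "C_on k S (\<lambda>y. inverse (f y))"
  using assms(2)
proof (induction k)
  case (Suc k)
  note D = C_on_SucD[OF assms(1) Suc.prems]
  have inv: "C_on k S (\<lambda>y. inverse (f y))"
    using Suc.IH Suc.prems C_on_Suc by blast
  show ?case
  proof (rule C_on_SucI[OF assms(1)])
    show "C_on k S (\<lambda>y. (- 1) * (partial i f y * (inverse (f y) * inverse (f y))))" for i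
      by (intro C_on_mult C_on_const inv D(2) assms(1))
  qed (simp_all add: partial_inverse assms(3) D(1))
qed (use assms in \<open>simp add: continuous_on_inverse\<close>)

lemma smooth_on_const: "smooth_on S (\<lambda>y. r)"
  by (simp add: smooth_on_def C_on_const)

lemma smooth_on_add: "open S \<Longrightarrow> smooth_on S f \<Longrightarrow> smooth_on S g \<Longrightarrow> smooth_on S (\<lambda>y. f y + g y)"
  by (simp add: smooth_on_def C_on_add)

lemma smooth_on_mult: "open S \<Longrightarrow> smooth_on S f \<Longrightarrow> smooth_on S g \<Longrightarrow> smooth_on S (\<lambda>y. f y * g y)"
  by (simp add: smooth_on_def C_on_mult)

lemma smooth_on_minus: "open S \<Longrightarrow> smooth_on S f \<Longrightarrow> smooth_on S (\<lambda>y. - f y)"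
  using smooth_on_mult[OF _ smooth_on_const[of S "- 1"]] by simp

lemma smooth_on_diff: "open S \<Longrightarrow> smooth_on S f \<Longrightarrow> smooth_on S g \<Longrightarrow> smooth_on S (\<lambda>y. f y - g y)"
  using smooth_on_add[OF _ _ smooth_on_minus] by simp

lemma smooth_on_divide:
  "open S \<Longrightarrow> smooth_on S f \<Longrightarrow> smooth_on S g \<Longrightarrow> (\<And>y. y \<in> S \<Longrightarrow> g y \<noteq> 0)
    \<Longrightarrow> smooth_on S (\<lambda>y. f y / g y)"
  by (simp add: divide_inverse smooth_on_def C_on_mult C_on_inverse)

lemma smooth_on_sum:
  "open S \<Longrightarrow> (\<And>m. m \<in> I \<Longrightarrow> smooth_on S (f m)) \<Longrightarrow> smooth_on S (\<lambda>y. \<Sum>m\<in>I. f m y)"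
  by (induction I rule: infinite_finite_induct) (simp_all add: smooth_on_const smooth_on_add)

lemma smooth_on_prod:
  "open S \<Longrightarrow> (\<And>m. m \<in> I \<Longrightarrow> smooth_on S (f m)) \<Longrightarrow> smooth_on S (\<lambda>y. \<Prod>m\<in>I. f m y)"
  by (induction I rule: infinite_finite_induct) (simp_all add: smooth_on_const smooth_on_mult)

lemmas smooth_on_intros = smooth_on_const smooth_on_add smooth_on_mult smooth_on_minus smooth_on_diff
  smooth_on_divide smooth_on_sum smooth_on_prod smooth_on_partial

section \<open>Smoothness of the curvature\<close>

lemma smooth_on_det:
  fixes H :: "real^'n \<Rightarrow> real^'m^'m"
  assumes "open S" "\<And>a b. smooth_on S (\<lambda>y. H y $ a $ b)"
  shows "smooth_on S (\<lambda>y. det (H y))"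
  unfolding det_def by (intro smooth_on_intros assms)

lemma matrix_inv_right:
  fixes H :: "real^'n^'n"
  assumes "det H \<noteq> 0"
  shows "H ** matrix_inv H = mat 1"
proof -
  have "invertible H" using assms by (simp add: invertible_det_nz)
  then show ?thesis unfolding invertible_def matrix_inv_def by (rule someI2_ex) simp
qed

text \<open>Cramer's rule exhibits the entries of the inverse as quotients of polynomials in the entries of the
matrix, whence the smoothness of everything that is built from the inverse metric.\<close>

lemma matrix_inv_cramer:
  fixes H :: "real^'n^'n"
  assumes "det H \<noteq> 0"
  shows "matrix_inv H $ k $ l = det (\<chi> i j. if j = k then axis l 1 $ i else H $ i $ j) / det H"
proof -
  have "H *v (matrix_inv H *v axis l 1) = axis l 1"
    by (simp add: matrix_vector_mul_assoc matrix_inv_right[OF assms])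
  then have "matrix_inv H *v axis l 1 = (\<chi> k. det (\<chi> i j. if j = k then axis l 1 $ i else H $ i $ j) / det H)"
    using cramer[OF assms] by blast
  then show ?thesis
    by (simp add: vec_eq_iff matrix_vector_mul_component inner_axis)
qed

lemma smooth_on_matrix_inv:
  fixes G :: "real^'n \<Rightarrow> real^'m^'m"
  assumes "open S" "\<And>a b. smooth_on S (\<lambda>y. G y $ a $ b)" "\<And>y. y \<in> S \<Longrightarrow> det (G y) \<noteq> 0"
  shows "smooth_on S (\<lambda>y. matrix_inv (G y) $ k $ l)"
proof (rule smooth_on_cong[OF assms(1)])
  have "smooth_on S (\<lambda>y. (\<chi> i j. if j = k then axis l 1 $ i else G y $ i $ j) $ a $ b)" for a b
    by (cases "b = k") (simp_all add: assms smooth_on_const)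
  then show "smooth_on S (\<lambda>y. det (\<chi> i j. if j = k then axis l 1 $ i else G y $ i $ j) / det (G y))"
    by (intro smooth_on_intros smooth_on_det assms)
qed (simp add: matrix_inv_cramer assms)

lemma smooth_on_christoffel:
  assumes "open S" "\<And>a b. smooth_on S (\<lambda>y. G y $ a $ b)" "\<And>y. y \<in> S \<Longrightarrow> det (G y) \<noteq> 0"
  shows "smooth_on S (\<lambda>y. christoffel G y k i j)"
  unfolding christoffel_def
  by (intro smooth_on_intros smooth_on_matrix_inv smooth_on_partial[where f = "\<lambda>y. G y $ _ $ _"] assms)

lemma smooth_on_riemann:
  assumes "open S" "\<And>a b. smooth_on S (\<lambda>y. G y $ a $ b)" "\<And>y. y \<in> S \<Longrightarrow> det (G y) \<noteq> 0"
  shows "smooth_on S (\<lambda>y. riemann G y l k i j)"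
  unfolding riemann_def
  by (intro smooth_on_add smooth_on_diff smooth_on_mult smooth_on_sum smooth_on_christoffel
      smooth_on_partial[where f = "\<lambda>y. christoffel G y _ _ _"] assms)

lemma smooth_on_gauss_coord:
  assumes "open S" "\<And>a b. smooth_on S (\<lambda>y. G y $ a $ b)" "\<And>y. y \<in> S \<Longrightarrow> det (G y) \<noteq> 0"
  shows "smooth_on S (gauss_coord G)"
  unfolding gauss_coord_def
  by (intro smooth_on_divide smooth_on_mult smooth_on_sum smooth_on_det smooth_on_riemann assms)

section \<open>Symmetry of second derivatives\<close>

lemma has_real_derivative_along_axis:
  assumes "f differentiable (at (w + s *\<^sub>R axis i 1))"
  shows "((\<lambda>s. f (w + s *\<^sub>R axis i 1)) has_real_derivative partial i f (w + s *\<^sub>R axis i 1)) (at s)"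
proof -
  let ?f' = "frechet_derivative f (at (w + s *\<^sub>R axis i 1))"
  have f': "(f has_derivative ?f') (at (w + s *\<^sub>R axis i 1))"
    using assms by (simp add: frechet_derivative_works)
  have "((\<lambda>s. w + s *\<^sub>R axis i 1) has_derivative (\<lambda>h. h *\<^sub>R axis i (1::real))) (at s)"
    by (auto intro!: derivative_eq_intros)
  then have "((\<lambda>s. f (w + s *\<^sub>R axis i 1)) has_derivative (\<lambda>h. ?f' (h *\<^sub>R axis i 1))) (at s)"
    by (rule has_derivative_compose) (rule f')
  then show ?thesis
    using has_derivative_linear[OF f']
    by (simp add: has_field_derivative_def partial_def linear_cmul mult_commute_abs)
qed

text \<open>The second difference is symmetric in \<^term>\<open>i\<close> and \<^term>\<open>j\<close>, whereas the order of the two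
applications of the mean value theorem decides which mixed derivative appears. The radius
\<^term>\<open>3 * t\<close> only has to exceed the distance \<^term>\<open>2 * t\<close> that the far corner of the
parallelogram can have from \<^term>\<open>x\<close> (it does when \<^term>\<open>i = j\<close>).\<close>

lemma second_difference_mvt:
  assumes diff: "\<And>y. dist y x < 3 * t \<Longrightarrow> f differentiable (at y) \<and> partial i f differentiable (at y)"
    and "t > 0"
  shows "\<exists>z. dist z x < 3 * t \<and>
    f (x + t *\<^sub>R axis i 1 + t *\<^sub>R axis j 1) - f (x + t *\<^sub>R axis i 1) - f (x + t *\<^sub>R axis j 1) + f x
      = t\<^sup>2 * partial j (partial i f) z"
proof -
  let ?ei = "axis i (1::real)" and ?ej = "axis j (1::real)"
  have near: "dist (x + s *\<^sub>R ?ei + u *\<^sub>R ?ej) x < 3 * t" if "0 \<le> s" "s \<le> t" "0 \<le> u" "u \<le> t" for s u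
  proof -
    have "norm (s *\<^sub>R ?ei + u *\<^sub>R ?ej) \<le> s + u"
      using norm_triangle_ineq[of "s *\<^sub>R ?ei" "u *\<^sub>R ?ej"] that by (simp add: norm_axis_1)
    then show ?thesis using that assms(2) by (simp add: dist_norm add.assoc)
  qed
  have d1: "((\<lambda>s. f (x + u *\<^sub>R ?ej + s *\<^sub>R ?ei)) has_real_derivative
      partial i f (x + u *\<^sub>R ?ej + s *\<^sub>R ?ei)) (at s)" if "0 \<le> s" "s \<le> t" "0 \<le> u" "u \<le> t" for s u
    using near[OF that] diff by (intro has_real_derivative_along_axis) (simp add: add_ac)
  have "\<exists>s>0. s < t \<and>
      (f (x + t *\<^sub>R ?ej + t *\<^sub>R ?ei) - f (x + 0 *\<^sub>R ?ej + t *\<^sub>R ?ei)) -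
      (f (x + t *\<^sub>R ?ej + 0 *\<^sub>R ?ei) - f (x + 0 *\<^sub>R ?ej + 0 *\<^sub>R ?ei))
      = (t - 0) * (partial i f (x + t *\<^sub>R ?ej + s *\<^sub>R ?ei) - partial i f (x + 0 *\<^sub>R ?ej + s *\<^sub>R ?ei))"
    using assms(2) by (intro MVT2 DERIV_diff d1) auto
  then obtain s where s: "0 < s" "s < t" and
    1: "f (x + t *\<^sub>R ?ei + t *\<^sub>R ?ej) - f (x + t *\<^sub>R ?ei) - f (x + t *\<^sub>R ?ej) + f x
      = t * (partial i f (x + s *\<^sub>R ?ei + t *\<^sub>R ?ej) - partial i f (x + s *\<^sub>R ?ei + 0 *\<^sub>R ?ej))"
    by (auto simp: algebra_simps)
  have "\<exists>u>0. u < t \<and>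
      partial i f (x + s *\<^sub>R ?ei + t *\<^sub>R ?ej) - partial i f (x + s *\<^sub>R ?ei + 0 *\<^sub>R ?ej)
      = (t - 0) * partial j (partial i f) (x + s *\<^sub>R ?ei + u *\<^sub>R ?ej)"
    using assms(2) s near[of s] diff by (intro MVT2 has_real_derivative_along_axis) auto
  then obtain u where u: "0 < u" "u < t" and
    2: "partial i f (x + s *\<^sub>R ?ei + t *\<^sub>R ?ej) - partial i f (x + s *\<^sub>R ?ei + 0 *\<^sub>R ?ej)
      = t * partial j (partial i f) (x + s *\<^sub>R ?ei + u *\<^sub>R ?ej)"
    by auto
  show ?thesis
    using near[of s u] s u unfolding 1 2 power2_eq_square by (auto simp: mult.assoc)
qed

text \<open>Schwarz's theorem: by the preceding lemma the same second difference, divided by $t^2$, is a value of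
either mixed derivative at a point close to \<^term>\<open>x\<close>, so continuity identifies them.\<close>

lemma partial_commute:
  assumes "open S" "x \<in> S" "C_on 2 S f"
  shows "partial i (partial j f) x = partial j (partial i f) x"
proof (rule ccontr)
  assume neq: "partial i (partial j f) x \<noteq> partial j (partial i f) x"
  define e where "e = dist (partial i (partial j f) x) (partial j (partial i f) x) / 2"
  have "e > 0" using neq by (simp add: e_def)
  have C: "f differentiable_on S" "\<And>i. partial i f differentiable_on S"
    "\<And>i j. continuous_on S (partial i (partial j f))"
    using assms(3) by (simp_all add: numeral_2_eq_2)
  have near: "\<exists>d>0. \<forall>z. dist z x < d \<longrightarrow> dist (partial i (partial j f) z) (partial i (partial j f) x) < e" for i j
    using C(3)[of i j] assms(1,2) \<open>e > 0\<close>
    by (metis continuous_at_eps_delta continuous_on_eq_continuous_at)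
  obtain d1 where d1: "d1 > 0" "\<And>z. dist z x < d1 \<Longrightarrow> dist (partial i (partial j f) z) (partial i (partial j f) x) < e"
    using near by blast
  obtain d2 where d2: "d2 > 0" "\<And>z. dist z x < d2 \<Longrightarrow> dist (partial j (partial i f) z) (partial j (partial i f) x) < e"
    using near by blast
  obtain d3 where d3: "d3 > 0" "\<And>z. dist z x < d3 \<Longrightarrow> z \<in> S"
    using assms(1,2) by (meson open_dist)
  define t where "t = min d1 (min d2 d3) / 3"
  have t: "t > 0" "3 * t \<le> d1" "3 * t \<le> d2" "3 * t \<le> d3"
    using d1(1) d2(1) d3(1) by (auto simp: t_def)
  have diff: "f differentiable (at y) \<and> partial k f differentiable (at y)" if "dist y x < 3 * t" for y k
    using C(1,2) assms(1) d3(2)[of y] that t by (simp add: differentiable_on_eq_differentiable_at)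
  obtain z where z: "dist z x < 3 * t" and
    1: "f (x + t *\<^sub>R axis j 1 + t *\<^sub>R axis i 1) - f (x + t *\<^sub>R axis j 1) - f (x + t *\<^sub>R axis i 1) + f x
      = t\<^sup>2 * partial i (partial j f) z"
    using second_difference_mvt[OF diff t(1)] by blast
  obtain w where w: "dist w x < 3 * t" and
    2: "f (x + t *\<^sub>R axis i 1 + t *\<^sub>R axis j 1) - f (x + t *\<^sub>R axis i 1) - f (x + t *\<^sub>R axis j 1) + f x
      = t\<^sup>2 * partial j (partial i f) w"
    using second_difference_mvt[OF diff t(1)] by blast
  have "t\<^sup>2 * partial i (partial j f) z = t\<^sup>2 * partial j (partial i f) w"
    using 1 2 by (simp add: algebra_simps)
  then have zw: "partial j (partial i f) w = partial i (partial j f) z"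
    using t(1) by simp
  have "dist (partial i (partial j f) x) (partial i (partial j f) z) < e"
    using d1(2)[of z] z t(2) by (simp add: dist_commute)
  moreover have "dist (partial j (partial i f) x) (partial i (partial j f) z) < e"
    using d2(2)[of w] w t(3) unfolding zw by (simp add: dist_commute)
  ultimately have "dist (partial i (partial j f) x) (partial j (partial i f) x) < e + e"
    using dist_triangle2[of "partial i (partial j f) x" "partial j (partial i f) x" "partial i (partial j f) z"]
    by linarith
  then show False by (simp add: e_def)
qed

section \<open>The Levi-Civita connection in coordinates\<close>

locale metric_coordinates =
  fixes S :: "(real^'n) set" and G :: "real^'n \<Rightarrow> real^'n^'n"
  assumes open_S: "open S"
    and smooth: "smooth_on S (\<lambda>y. G y $ a $ b)"
    and sym: "y \<in> S \<Longrightarrow> transpose (G y) = G y"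
    and nondeg: "y \<in> S \<Longrightarrow> det (G y) \<noteq> 0"
begin

abbreviation \<Gamma> :: "real^'n \<Rightarrow> 'n \<Rightarrow> 'n \<Rightarrow> 'n \<Rightarrow> real" where
  "\<Gamma> \<equiv> christoffel G"

lemma metric_differentiable: "y \<in> S \<Longrightarrow> (\<lambda>y. G y $ a $ b) differentiable (at y)"
  by (rule smooth_on_differentiable[OF open_S smooth])

lemma smooth_christoffel: "smooth_on S (\<lambda>y. \<Gamma> y k i j)"
  by (intro smooth_on_christoffel open_S smooth nondeg)

lemma christoffel_differentiable: "y \<in> S \<Longrightarrow> (\<lambda>y. \<Gamma> y k i j) differentiable (at y)"
  by (rule smooth_on_differentiable[OF open_S smooth_christoffel])

lemma metric_sym: "y \<in> S \<Longrightarrow> G y $ a $ b = G y $ b $ a"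
  using arg_cong[OF sym, of y "\<lambda>m. m $ b $ a"] by (simp add: transpose_def)

lemma christoffel_sym: "y \<in> S \<Longrightarrow> \<Gamma> y k i j = \<Gamma> y k j i"
  by (rule christoffel_torsion_free[OF open_S _ sym metric_differentiable])

lemma partial_metric:
  assumes "y \<in> S"
  shows "partial k (\<lambda>y. G y $ i $ j) y
    = (\<Sum>m\<in>UNIV. \<Gamma> y m k i * G y $ m $ j) + (\<Sum>m\<in>UNIV. \<Gamma> y m k j * G y $ m $ i)"
  using christoffel_metric[OF open_S assms sym metric_differentiable[OF assms] nondeg[OF assms], of k i j]
    metric_sym[OF assms, of i]
  by simp

text \<open>The skew symmetry of $R_{lcij}$ in $l, c$ is the integrability condition of metricity: writing
$\partial_j g_{cl}$ through the Christoffel symbols and commuting the second derivatives of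
$g_{cl}$ leaves $R_{lcij} + R_{clij} = 0$, since the other quadratic terms cancel by the symmetry of $g$.\<close>

lemma lowered_riemann_skew:
  assumes x: "x \<in> S"
  shows "(\<Sum>m\<in>UNIV. riemann G x m c i j * G x $ m $ l)
    = - (\<Sum>m\<in>UNIV. riemann G x m l i j * G x $ m $ c)"
proof -
  note [simp] = christoffel_differentiable[OF x] metric_differentiable[OF x]
  \<comment> \<open>The Christoffel symbols with lowered index, in terms of which metricity reads $\partial_j g_{cl} = L_{jcl} + L_{jlc}$.\<close>
  define L where "L y j c l = (\<Sum>m\<in>UNIV. \<Gamma> y m j c * G y $ m $ l)" for y j c l
  have L_diff: "(\<lambda>y. L y j c l) differentiable (at x)" for j c l
    unfolding L_def by simp
  have pL: "partial i (\<lambda>y. L y j c l) x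
      = (\<Sum>m\<in>UNIV. partial i (\<lambda>y. \<Gamma> y m j c) x * G x $ m $ l)
        + (\<Sum>m\<in>UNIV. \<Gamma> x m j c * L x i m l) + (\<Sum>m\<in>UNIV. \<Gamma> x m j c * L x i l m)" for i j c l
    unfolding L_def
    by (subst partial_sum) (simp_all add: partial_mult partial_metric[OF x] distrib_left sum.distrib)
  have second: "partial i (partial j (\<lambda>y. G y $ c $ l)) x
      = partial i (\<lambda>y. L y j c l) x + partial i (\<lambda>y. L y j l c) x" for i j
  proof -
    have "partial i (partial j (\<lambda>y. G y $ c $ l)) x = partial i (\<lambda>y. L y j c l + L y j l c) x"
      by (rule partial_cong[OF open_S x]) (simp add: partial_metric L_def)
    then show ?thesis by (simp add: partial_add L_diff)
  qed
  have quad: "(\<Sum>m\<in>UNIV. \<Gamma> x m j c * L x i m l)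
      = (\<Sum>m\<in>UNIV. (\<Sum>p\<in>UNIV. \<Gamma> x m i p * \<Gamma> x p j c) * G x $ m $ l)" for i j c l
    unfolding L_def sum_distrib_left sum_distrib_right
    by (subst sum.swap) (simp only: mult_ac)
  have cross: "(\<Sum>m\<in>UNIV. \<Gamma> x m j c * L x i l m) = (\<Sum>m\<in>UNIV. \<Gamma> x m i l * L x j c m)" for i j c l
    unfolding L_def sum_distrib_left
    by (subst sum.swap) (simp only: mult_ac metric_sym[OF x])
  have riem: "(\<Sum>m\<in>UNIV. riemann G x m c i j * G x $ m $ l)
      = (\<Sum>m\<in>UNIV. partial i (\<lambda>y. \<Gamma> y m j c) x * G x $ m $ l)
        - (\<Sum>m\<in>UNIV. partial j (\<lambda>y. \<Gamma> y m i c) x * G x $ m $ l)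
        + (\<Sum>m\<in>UNIV. \<Gamma> x m j c * L x i m l) - (\<Sum>m\<in>UNIV. \<Gamma> x m i c * L x j m l)" for c l
    unfolding quad riemann_def
    by (simp only: distrib_right left_diff_distrib sum.distrib sum_subtractf)
  have "partial i (partial j (\<lambda>y. G y $ c $ l)) x = partial j (partial i (\<lambda>y. G y $ c $ l)) x"
    using partial_commute[OF open_S x] smooth unfolding smooth_on_def by blast
  then show ?thesis
    unfolding second pL riem
    using cross[of j c i l] cross[of j l i c] by linarith
qed

definition cov_deriv :: "(real^'n \<Rightarrow> real^'n) \<Rightarrow> real^'n \<Rightarrow> 'n \<Rightarrow> 'n \<Rightarrow> real" where
  "cov_deriv X y a b = partial a (\<lambda>y. X y $ b) y - (\<Sum>m\<in>UNIV. \<Gamma> y m a b * X y $ m)"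

text \<open>Torsion-freeness makes closedness independent of the metric.\<close>

lemma antisymm_cov_deriv:
  assumes "x \<in> S"
  shows "antisymm (cov_deriv X x) a b = 1/2 * (partial a (\<lambda>y. X y $ b) x - partial b (\<lambda>y. X y $ a) x)"
  unfolding antisymm_def cov_deriv_def by (simp add: christoffel_sym[OF assms, of _ b a])

text \<open>$\nabla_i \nabla_j X_c - \nabla_j \nabla_i X_c = - R^m{}_{cij} X_m$. The terms of the left-hand side in
which the connection acts on the index of the first derivative cancel by torsion-freeness and are
left out from the start.\<close>

lemma ricci_identity:
  assumes x: "x \<in> S" and X: "\<And>a. smooth_on S (\<lambda>y. X y $ a)"
  shows "partial i (\<lambda>y. cov_deriv X y j c) x - partial j (\<lambda>y. cov_deriv X y i c) x
      - (\<Sum>m\<in>UNIV. \<Gamma> x m i c * cov_deriv X x j m) + (\<Sum>m\<in>UNIV. \<Gamma> x m j c * cov_deriv X x i m)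
    = - (\<Sum>m\<in>UNIV. riemann G x m c i j * X x $ m)"
proof -
  note [simp] = christoffel_differentiable[OF x] smooth_on_differentiable[OF open_S X x]
    smooth_on_differentiable[OF open_S smooth_on_partial[OF X] x]
  have pX: "partial i (\<lambda>y. X y $ m) x = cov_deriv X x i m + (\<Sum>p\<in>UNIV. \<Gamma> x p i m * X x $ p)" for i m
    by (simp add: cov_deriv_def)
  have quad: "(\<Sum>m\<in>UNIV. \<Gamma> x m j c * (\<Sum>p\<in>UNIV. \<Gamma> x p i m * X x $ p))
      = (\<Sum>m\<in>UNIV. (\<Sum>p\<in>UNIV. \<Gamma> x m i p * \<Gamma> x p j c) * X x $ m)" for i j
    unfolding sum_distrib_left sum_distrib_right by (subst sum.swap) (simp only: mult_ac)
  have D: "partial i (\<lambda>y. cov_deriv X y j c) x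
      = partial i (partial j (\<lambda>y. X y $ c)) x
        - (\<Sum>m\<in>UNIV. partial i (\<lambda>y. \<Gamma> y m j c) x * X x $ m)
        - (\<Sum>m\<in>UNIV. \<Gamma> x m j c * cov_deriv X x i m)
        - (\<Sum>m\<in>UNIV. (\<Sum>p\<in>UNIV. \<Gamma> x m i p * \<Gamma> x p j c) * X x $ m)" for i j
    unfolding quad[symmetric] cov_deriv_def[of X _ j c]
    by (simp add: partial_diff partial_sum partial_mult pX distrib_left sum.distrib)
  have "partial i (partial j (\<lambda>y. X y $ c)) x = partial j (partial i (\<lambda>y. X y $ c)) x"
    using partial_commute[OF open_S x] X unfolding smooth_on_def by blast
  moreover have "(\<Sum>m\<in>UNIV. riemann G x m c i j * X x $ m)
      = (\<Sum>m\<in>UNIV. partial i (\<lambda>y. \<Gamma> y m j c) x * X x $ m)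
        - (\<Sum>m\<in>UNIV. partial j (\<lambda>y. \<Gamma> y m i c) x * X x $ m)
        + (\<Sum>m\<in>UNIV. (\<Sum>p\<in>UNIV. \<Gamma> x m i p * \<Gamma> x p j c) * X x $ m)
        - (\<Sum>m\<in>UNIV. (\<Sum>p\<in>UNIV. \<Gamma> x m j p * \<Gamma> x p i c) * X x $ m)"
    unfolding riemann_def by (simp only: distrib_right left_diff_distrib sum.distrib sum_subtractf)
  ultimately show ?thesis
    unfolding D by linarith
qed

text \<open>If $\nabla_a X_b$ is an algebraic expression in $X$, then the Ricci identity turns into an
equation without derivatives of $X$. The terms in $\mu\,\nabla g$ vanish by metricity, and those of
$\nabla_{[i} X_{j]}$ because the right-hand side of the assumption is symmetric.\<close>

lemma prolongation:
  assumes x: "x \<in> S" and X: "\<And>a. smooth_on S (\<lambda>y. X y $ a)" and \<mu>: "\<mu> differentiable (at x)"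
    and eq: "\<And>y a b. y \<in> S \<Longrightarrow> cov_deriv X y a b = \<mu> y * G y $ a $ b - r * X y $ a * X y $ b"
  shows "- (\<Sum>m\<in>UNIV. riemann G x m c i j * X x $ m)
    = (partial i \<mu> x + r * \<mu> x * X x $ i) * G x $ j $ c - (partial j \<mu> x + r * \<mu> x * X x $ j) * G x $ i $ c"
proof -
  note [simp] = \<mu> metric_differentiable[OF x] smooth_on_differentiable[OF open_S X x]
  \<comment> \<open>The derivatives of $X$ and of the metric are eliminated in favour of $\mu$, $X$ and the connection terms $V$ and $L$; these then cancel by their symmetry alone.\<close>
  define V where "V i m = (\<Sum>p\<in>UNIV. \<Gamma> x p i m * X x $ p)" for i m
  define L where "L j c l = (\<Sum>m\<in>UNIV. \<Gamma> x m j c * G x $ m $ l)" for j c l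
  have pX: "partial i (\<lambda>y. X y $ m) x = \<mu> x * G x $ i $ m - r * X x $ i * X x $ m + V i m" for i m
    using eq[OF x, of i m] by (simp add: cov_deriv_def V_def)
  have D: "partial i (\<lambda>y. cov_deriv X y j c) x
      = partial i \<mu> x * G x $ j $ c + \<mu> x * (L i j c + L i c j)
        - r * ((\<mu> x * G x $ i $ j - r * X x $ i * X x $ j + V i j) * X x $ c
               + X x $ j * (\<mu> x * G x $ i $ c - r * X x $ i * X x $ c + V i c))" for i j
  proof -
    have "partial i (\<lambda>y. cov_deriv X y j c) x = partial i (\<lambda>y. \<mu> y * G y $ j $ c - r * (X y $ j * X y $ c)) x"
      by (rule partial_cong[OF open_S x]) (simp add: eq)
    also have "\<dots> = partial i \<mu> x * G x $ j $ c + \<mu> x * partial i (\<lambda>y. G y $ j $ c) x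
        - r * (partial i (\<lambda>y. X y $ j) x * X x $ c + X x $ j * partial i (\<lambda>y. X y $ c) x)"
      by (simp add: partial_diff partial_mult partial_cmult partial_const)
    finally show ?thesis
      by (simp only: pX partial_metric[OF x] L_def)
  qed
  have C: "(\<Sum>m\<in>UNIV. \<Gamma> x m i c * cov_deriv X x j m) = \<mu> x * L i c j - r * X x $ j * V i c" for i j
    unfolding eq[OF x] L_def V_def sum_distrib_left right_diff_distrib sum_subtractf
    by (simp only: mult_ac metric_sym[OF x, of j])
  have sym: "L i j c = L j i c" "V i j = V j i" "G x $ i $ j = G x $ j $ i"
    unfolding L_def V_def by (simp_all only: christoffel_sym[OF x, of _ i j] metric_sym[OF x, of i j])
  show ?thesis
    unfolding ricci_identity[OF x X, symmetric] D C
    by (simp add: sym algebra_simps)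
qed

end

section \<open>Surfaces\<close>

locale metric_coordinates_2 = metric_coordinates S G for S and G :: "real^2 \<Rightarrow> real^2^2"
begin

text \<open>In dimension two the skew symmetry in both index pairs leaves a single independent component of
$R_{lcij}$, which is $K \det g$. Raising the first index then amounts to solving two linear systems
with matrix $g$.\<close>

lemma riemann_2:
  assumes x: "x \<in> S"
  defines "K \<equiv> gauss_coord G x"
  shows "riemann G x 1 1 1 2 = K * G x $ 1 $ 2" "riemann G x 2 1 1 2 = - K * G x $ 1 $ 1"
    "riemann G x 1 2 1 2 = K * G x $ 2 $ 2" "riemann G x 2 2 1 2 = - K * G x $ 1 $ 2"
proof -
  \<comment> \<open>Abstract names for the components turn the claim into plain linear algebra.\<close>
  define a b d where abd: "a = G x $ 1 $ 1" "b = G x $ 1 $ 2" "d = G x $ 2 $ 2"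
  define p q r s where pqrs: "p = riemann G x 1 1 1 2" "q = riemann G x 2 1 1 2" "r = riemann G x 1 2 1 2"
    "s = riemann G x 2 2 1 2"
  have b: "G x $ 2 $ 1 = b"
    using metric_sym[OF x] by (simp add: abd)
  have D: "a * d - b * b \<noteq> 0"
    using nondeg[OF x] b by (simp add: det_2 abd)
  have 1: "p * a + q * b = 0" "r * b + s * d = 0" "p * b + q * d = - (r * a + s * b)"
    using lowered_riemann_skew[OF x, of 1 1 2 1] lowered_riemann_skew[OF x, of 2 1 2 2]
      lowered_riemann_skew[OF x, of 1 1 2 2]
    unfolding sum_2 b abd[symmetric] pqrs[symmetric] by linarith+
  have K: "r * a + s * b = K * (a * d - b * b)"
    using D b unfolding K_def gauss_coord_def by (simp add: sum_2 det_2 mult_ac flip: abd pqrs)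
  have "(a * d - b * b) * p = (a * d - b * b) * (K * b)"
    "(a * d - b * b) * q = (a * d - b * b) * (- K * a)"
    "(a * d - b * b) * r = (a * d - b * b) * (K * d)"
    "(a * d - b * b) * s = (a * d - b * b) * (- K * b)"
    using 1 K by algebra+
  then show "riemann G x 1 1 1 2 = K * G x $ 1 $ 2" "riemann G x 2 1 1 2 = - K * G x $ 1 $ 1"
    "riemann G x 1 2 1 2 = K * G x $ 2 $ 2" "riemann G x 2 2 1 2 = - K * G x $ 1 $ 2"
    unfolding mult_cancel_left abd[symmetric] pqrs[symmetric] using D by auto
qed

lemma ricci_2:
  assumes x: "x \<in> S"
  shows "ricci G x a b = gauss_coord G x * G x $ a $ b"
proof -
  have "riemann G x m k i j = - riemann G x m k j i" for m k i j
    unfolding riemann_def by (simp add: sum_subtractf)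
  from this[of _ _ 1 1] this[of _ _ 2 2] this[of _ _ 2 1] show ?thesis
    using exhaust_2[of a] exhaust_2[of b] metric_sym[OF x, of 2 1]
    by (auto simp: ricci_def sum_2 riemann_2[OF x])
qed

text \<open>With $\mu = c_2 K + \lambda$ the prolonged equation reads $Y_1 g_{2c} = Y_2 g_{1c}$ for
$Y = c_2\, dK + ((1 + c_1 c_2) K + \lambda c_1) X$. Since $g$ is nondegenerate, its two rows are
linearly independent, and $Y = 0$.\<close>

lemma gradient_soliton_2:
  assumes x: "x \<in> S" and X: "\<And>a. smooth_on S (\<lambda>y. X y $ a)"
    and closed: "\<And>y a b. y \<in> S \<Longrightarrow> antisymm (cov_deriv X y) a b = 0"
    and soliton: "\<And>y a b. y \<in> S \<Longrightarrow>
      symm (cov_deriv X y) a b + c1 * X y $ a * X y $ b - c2 * ricci G y a b = lam * G y $ a $ b"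
  shows "c2 * partial a (gauss_coord G) x + ((1 + c1 * c2) * gauss_coord G x + lam * c1) * X x $ a = 0"
proof -
  define \<mu> where "\<mu> y = c2 * gauss_coord G y + lam" for y
  have K: "gauss_coord G differentiable (at x)"
    by (rule smooth_on_differentiable[OF open_S smooth_on_gauss_coord[OF open_S smooth nondeg] x])
  have "cov_deriv X y a b = \<mu> y * G y $ a $ b - c1 * X y $ a * X y $ b" if "y \<in> S" for y a b
    using closed[OF that, of a b] soliton[OF that, of a b] ricci_2[OF that, of a b]
    by (simp add: antisymm_def symm_def \<mu>_def algebra_simps)
  moreover have "\<mu> differentiable (at x)"
    unfolding \<mu>_def using K by simp
  ultimately have P: "- (\<Sum>m\<in>UNIV. riemann G x m c 1 2 * X x $ m)
    = (partial 1 \<mu> x + c1 * \<mu> x * X x $ 1) * G x $ 2 $ c - (partial 2 \<mu> x + c1 * \<mu> x * X x $ 2) * G x $ 1 $ c" for c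
    using prolongation[OF x X] by blast
  have \<mu>': "partial i \<mu> x = c2 * partial i (gauss_coord G) x" for i
    unfolding \<mu>_def using K by (simp add: partial_add partial_cmult partial_const)
  define Y where "Y a = c2 * partial a (gauss_coord G) x + ((1 + c1 * c2) * gauss_coord G x + lam * c1) * X x $ a" for a
  have b: "G x $ 2 $ 1 = G x $ 1 $ 2" by (rule metric_sym[OF x])
  have Y: "Y 1 * G x $ 2 $ c = Y 2 * G x $ 1 $ c" for c
    using P[of c] exhaust_2[of c] 
    by (auto simp: Y_def \<mu>' \<mu>_def sum_2 riemann_2[OF x] b algebra_simps)
  \<comment> \<open>As in Cramer's rule, a combination of the equations for $c = 1, 2$ with a row of $g$ as coefficients eliminates one unknown.\<close>
  have "det (G x) * Y 1 = 0" "det (G x) * Y 2 = 0"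
    using Y[of 1] Y[of 2] unfolding det_2 b by algebra+
  then have "Y a = 0"
    using nondeg[OF x] exhaust_2[of a] by auto
  then show ?thesis by (simp add: Y_def)
qed

end

section \<open>Charts and changes of coordinates\<close>

lemma chart_inv_coord:
  assumes "is_chart M c" "p \<in> chart_dom c"
  shows "chart_inv c (coord c p) = p"
proof -
  have "inj_on (coord c) (topspace (subtopology M (chart_dom c)))"
    using assms(1) homeomorphic_imp_injective_map unfolding is_chart_def by blast
  moreover have "topspace (subtopology M (chart_dom c)) = chart_dom c"
    using assms(1) openin_subset unfolding is_chart_def by (metis topspace_subtopology_subset)
  ultimately show ?thesis
    using assms(2) by (simp add: chart_inv_def)
qed

lemma chart_inv_in_dom: "x \<in> chart_ran c \<Longrightarrow> chart_inv c x \<in> chart_dom c"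
  unfolding chart_inv_def by (rule inv_into_into)

lemma coord_chart_inv: "x \<in> chart_ran c \<Longrightarrow> coord c (chart_inv c x) = x"
  unfolding chart_inv_def by (rule f_inv_into_f)

text \<open>Openness makes the smoothness of the transition functions on the overlap a statement about genuine
derivatives.\<close>

lemma open_overlap:
  assumes c: "is_chart M c" and d: "is_chart M d"
  shows "open (overlap c d)"
proof -
  have "open_map (subtopology M (chart_dom c)) (top_of_set (chart_ran c)) (coord c)"
    using c homeomorphic_imp_open_map unfolding is_chart_def by blast
  moreover have "openin (subtopology M (chart_dom c)) (chart_dom c \<inter> chart_dom d)"
    using d unfolding is_chart_def by (intro openin_subtopology_Int2) simp
  ultimately have "openin (top_of_set (chart_ran c)) (overlap c d)"
    unfolding open_map_def overlap_def by blast
  then show ?thesis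
    using c openin_open_eq unfolding is_chart_def by blast
qed

lemma transition_overlap:
  assumes "is_chart M c" "is_chart M d" "x \<in> overlap c d"
  shows "transition c d x \<in> chart_ran d" "chart_inv d (transition c d x) = chart_inv c x"
proof -
  obtain p where p: "p \<in> chart_dom c" "p \<in> chart_dom d" "x = coord c p"
    using assms(3) by (auto simp: overlap_def)
  then show "transition c d x \<in> chart_ran d" "chart_inv d (transition c d x) = chart_inv c x"
    using chart_inv_coord[OF assms(1), of p] chart_inv_coord[OF assms(2), of p]
    by (auto simp: transition_def)
qed

text \<open>The differential of a function is a covector field: this is the chain rule for
$f \circ c^{-1} = (f \circ d^{-1}) \circ (d \circ c^{-1})$.\<close>

lemma nabla_scalar_transform:
  assumes M: "smooth_manifold M A" and c: "c \<in> A" "d \<in> A" and x: "x \<in> overlap c d"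
    and f: "smooth_on (chart_ran d) (\<lambda>y. f (chart_inv d y))"
  shows "nabla_scalar c f x a
    = (\<Sum>k\<in>UNIV. transition_jac c d x k a * nabla_scalar d f (transition c d x) k)"
proof -
  have charts: "is_chart M c" "is_chart M d" and T: "\<And>k. smooth_on (overlap c d) (\<lambda>x. transition c d x $ k)"
    using M c unfolding smooth_manifold_def by blast+
  have "open (chart_ran d)"
    using charts(2) by (simp add: is_chart_def)
  note fd = smooth_on_differentiable[OF this f transition_overlap(1)[OF charts x]]
  note Td = smooth_on_differentiable[OF open_overlap[OF charts] T x]
  have "nabla_scalar c f x a = partial a (\<lambda>y. f (chart_inv d (transition c d y))) x"
    unfolding nabla_scalar_def
    by (rule partial_cong[OF open_overlap[OF charts] x]) (simp add: transition_overlap(2)[OF charts])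
  also have "\<dots> = (\<Sum>k\<in>UNIV. transition_jac c d x k a * nabla_scalar d f (transition c d x) k)"
    unfolding nabla_scalar_def transition_jac_def using fd Td by (rule partial_compose)
  finally show ?thesis .
qed

section \<open>Gradient generalised Ricci solitons on surfaces\<close>

lemma pseudo_riemannian_chart:
  assumes "pseudo_riemannian_manifold M A g" "c \<in> A"
  shows "is_chart M c" "metric_coordinates (chart_ran c) (g c)"
proof -
  show "is_chart M c"
    using assms unfolding pseudo_riemannian_manifold_def smooth_manifold_def by blast
  then show "metric_coordinates (chart_ran c) (g c)"
    using assms
    by unfold_locales (auto simp: pseudo_riemannian_manifold_def smooth_cotensor2_def is_chart_def)
qed

text \<open>A form $k\,du / (r u + s)$ is closed, since it is the product of an exact form and a function of $u$:
the derivative of the denominator contributes a multiple of $\partial_a u\,\partial_b u$, which is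
symmetric, and the second derivatives of $u$ commute.\<close>

lemma antisymm_nabla_quotient:
  assumes S: "metric_coordinates S (g c)" and x: "x \<in> S"
    and u: "smooth_on S u" and h: "\<And>y. y \<in> S \<Longrightarrow> r * u y + s \<noteq> 0"
    and X: "\<And>y a. y \<in> S \<Longrightarrow> X c y $ a = k * partial a u y / (r * u y + s)"
  shows "antisymm (nabla g X c x) a b = 0"
proof -
  interpret metric_coordinates S "g c" by fact
  note d = smooth_on_differentiable[OF open_S _ x]
  note [simp] = d[OF u] d[OF smooth_on_partial[OF u]]
  have "nabla g X c x = cov_deriv (X c) x"
    by (intro ext) (simp add: nabla_def cov_deriv_def)
  moreover have "partial i (\<lambda>y. X c y $ j) x
      = k * partial i (partial j u) x / (r * u x + s)
        - k * r * partial i u x * partial j u x / (r * u x + s)\<^sup>2" for i j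
  proof -
    have "partial i (\<lambda>y. X c y $ j) x = partial i (\<lambda>y. k * partial j u y * inverse (r * u y + s)) x"
      by (rule partial_cong[OF open_S x]) (simp add: X divide_inverse)
    also have "\<dots> = k * partial i (partial j u) x / (r * u x + s)
        - k * r * partial i u x * partial j u x / (r * u x + s)\<^sup>2"
      using h[OF x]
      by (simp add: partial_mult partial_inverse partial_add partial_const divide_inverse power2_eq_square)
    finally show ?thesis .
  qed
  moreover have "partial a (partial b u) x = partial b (partial a u) x"
    using partial_commute[OF open_S x] u unfolding smooth_on_def by blast
  ultimately show ?thesis
    by (simp add: antisymm_cov_deriv[OF x])
qed

theorem proposition3p3:
  fixes M :: "'a topology" and A :: "('a, 2) chart set" and g :: "('a, 2) cotensor2_field"
    and K :: "'a \<Rightarrow> real" and c\<^sub>1 c\<^sub>2 lam :: real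
  assumes "pseudo_riemannian_manifold M A g"
    and "is_gauss_curvature A g K"
    and "\<forall>p\<in>topspace M. (1 + c\<^sub>1 * c\<^sub>2) * K p + lam * c\<^sub>1 \<noteq> 0"
  shows "(\<forall>X. smooth_one_form A X \<and> closed_one_form A g X \<and> gen_ricci_soliton A g c\<^sub>1 c\<^sub>2 lam X \<longrightarrow>
            (\<forall>c\<in>A. \<forall>x\<in>chart_ran c. \<forall>a.
               X c x $ a = - (c\<^sub>2 * nabla_scalar c K x a /
                              ((1 + c\<^sub>1 * c\<^sub>2) * K (chart_inv c x) + lam * c\<^sub>1))))
       \<and> (\<forall>X. (\<forall>c\<in>A. \<forall>x\<in>chart_ran c. \<forall>a.
               X c x $ a = - (c\<^sub>2 * nabla_scalar c K x a /
                              ((1 + c\<^sub>1 * c\<^sub>2) * K (chart_inv c x) + lam * c\<^sub>1))) \<and>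
            gen_ricci_soliton A g c\<^sub>1 c\<^sub>2 lam X \<longrightarrow>
            gradient_gen_ricci_soliton A g c\<^sub>1 c\<^sub>2 lam X)"
proof -
  let ?h = "\<lambda>c x. (1 + c\<^sub>1 * c\<^sub>2) * K (chart_inv c x) + lam * c\<^sub>1"
  have M: "smooth_manifold M A"
    using assms(1) by (simp add: pseudo_riemannian_manifold_def)
  note chart = pseudo_riemannian_chart[OF assms(1)]
  have K_coord: "K (chart_inv c y) = gauss_coord (g c) y" if "c \<in> A" "y \<in> chart_ran c" for c y
    using assms(2) that chart_inv_in_dom[OF that(2)] coord_chart_inv[OF that(2)]
    by (simp add: is_gauss_curvature_def)
  have h_nonzero: "?h c y \<noteq> 0" if "c \<in> A" "y \<in> chart_ran c" for c y
  proof -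
    have "chart_inv c y \<in> topspace M"
      using M that(1) chart_inv_in_dom[OF that(2)] unfolding smooth_manifold_def by blast
    then show ?thesis using assms(3) by blast
  qed
  have K_smooth: "smooth_on (chart_ran c) (\<lambda>y. K (chart_inv c y))" if "c \<in> A" for c
  proof -
    interpret metric_coordinates "chart_ran c" "g c" using chart(2) that .
    show ?thesis
      using smooth_on_gauss_coord[OF open_S smooth nondeg]
      by (rule smooth_on_cong[OF open_S]) (simp_all add: K_coord that)
  qed
  show ?thesis
  proof (intro conjI allI impI ballI)
    fix X c x a
    assume X: "smooth_one_form A X \<and> closed_one_form A g X \<and> gen_ricci_soliton A g c\<^sub>1 c\<^sub>2 lam X"
      and c: "c \<in> A" and x: "x \<in> chart_ran c"
    interpret metric_coordinates "chart_ran c" "g c" using chart(2) c .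
    interpret metric_coordinates_2 "chart_ran c" "g c" ..
    have cov_deriv: "cov_deriv (X c) y = nabla g X c y" for y
      by (intro ext) (simp add: nabla_def cov_deriv_def)
    \<comment> \<open>The formula is local, so that it suffices to argue in a single chart.\<close>
    have "c\<^sub>2 * partial a (gauss_coord (g c)) x
        + ((1 + c\<^sub>1 * c\<^sub>2) * gauss_coord (g c) x + lam * c\<^sub>1) * X c x $ a = 0"
      using X c
      by (intro gradient_soliton_2[OF x])
        (auto simp: cov_deriv smooth_one_form_def closed_one_form_def gen_ricci_soliton_def)
    moreover have "partial a (gauss_coord (g c)) x = nabla_scalar c K x a"
      unfolding nabla_scalar_def by (rule partial_cong[OF open_S x]) (simp add: K_coord c)
    ultimately show "X c x $ a = - (c\<^sub>2 * nabla_scalar c K x a / ?h c x)"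
      using h_nonzero[OF c x] by (simp add: K_coord[OF c x] field_simps)
  next
    fix X
    assume X: "(\<forall>c\<in>A. \<forall>x\<in>chart_ran c. \<forall>a. X c x $ a = - (c\<^sub>2 * nabla_scalar c K x a / ?h c x)) \<and>
      gen_ricci_soliton A g c\<^sub>1 c\<^sub>2 lam X"
    then have XK: "X c x $ a = - (c\<^sub>2 * nabla_scalar c K x a / ?h c x)" if "c \<in> A" "x \<in> chart_ran c" for c x a
      using that by blast
    have "smooth_on (chart_ran c) (\<lambda>x. X c x $ a)" if c: "c \<in> A" for c a
    proof -
      interpret metric_coordinates "chart_ran c" "g c" using chart(2) c .
      have "smooth_on (chart_ran c) (\<lambda>x. - (c\<^sub>2 * nabla_scalar c K x a / ?h c x))"
        unfolding nabla_scalar_def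
        by (intro smooth_on_minus smooth_on_divide smooth_on_mult smooth_on_add smooth_on_const
            smooth_on_partial K_smooth c open_S h_nonzero)
      then show ?thesis
        by (rule smooth_on_cong[OF open_S]) (simp add: XK c)
    qed
    moreover have "X c x $ a = (\<Sum>k\<in>UNIV. transition_jac c d x k a * X d (transition c d x) $ k)"
      if c: "c \<in> A" "d \<in> A" and x: "x \<in> overlap c d" for c d x a
    proof -
      note T = transition_overlap[OF chart(1)[OF c(1)] chart(1)[OF c(2)] x]
      have "x \<in> chart_ran c" using x by (auto simp: overlap_def)
      then show ?thesis
        by (simp add: XK c T nabla_scalar_transform[OF M c x K_smooth[OF c(2)]]
            sum_distrib_left sum_divide_distrib mult_ac flip: sum_negf)
    qed
    ultimately have "smooth_one_form A X"
      unfolding smooth_one_form_def by blast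
    moreover have "closed_one_form A g X"
      unfolding closed_one_form_def
    proof (intro ballI allI)
      fix c x a b
      assume c: "c \<in> A" and x: "x \<in> chart_ran c"
      show "antisymm (nabla g X c x) a b = 0"
      proof (rule antisymm_nabla_quotient[where g = g and c = c, OF chart(2)[OF c] x K_smooth[OF c]])
        show "X c y $ a = - c\<^sub>2 * partial a (\<lambda>y. K (chart_inv c y)) y / ?h c y" if "y \<in> chart_ran c" for y a
          using XK[OF c that] by (simp add: nabla_scalar_def)
      qed (rule h_nonzero[OF c])
    qed
    ultimately show "gradient_gen_ricci_soliton A g c\<^sub>1 c\<^sub>2 lam X"
      using X by (simp add: gradient_gen_ricci_soliton_def)
  qed
qed

end
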